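(* Let $z$ be a complex number (or an indeterminate). For every integer $n\ge 0$, $$\sum_{\substack{\tilde\pi \in \mathcal{O}_4 \\ \sigma(\tilde\pi)=n}} z^{\nu(\tilde\pi)}(1-z^2)^{N_5(\tilde\pi)}=\sum_{\substack{\pi \in \mathcal{D}_{2,4} \\ \sigma(\pi)=n}} z^{\nu(\pi;1,2)}(-z^2)^{\nu(\pi;0,2)}.$$
   Context: $\mathcal{O}_4$ is the set of partitions into odd parts such that any two parts differ by at least $4$ (so parts are distinct). For $\tilde\pi\in\mathcal{O}_4$, a chain is a maximal string of consecutive parts of $\tilde\pi$ differing by exactly $4$ (a part differing by more than 4 from its neighbours forms a chain by itself); $N_\lambda(\tilde\pi)$ is the number of chains of $\tilde\pi$ whose least part is $\ge\lambda$. $\mathcal{D}_{2,4}$ is the set of partitions into distinct parts none of which is $\equiv 2 \pmod 4$. For a partition $\pi$: $\sigma(\pi)$ is the sum of its parts, $\nu(\pi)$ is its number of parts, and $\nu(\pi;r,m)$ is the number of its parts that are $\equiv r \pmod m$. *)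

theory Defs
  imports Complex_Main "HOL-Number_Theory.Cong"
begin

text \<open>
  A partition is the weakly decreasing list of its (positive) parts, so the sum of its parts is
  \<^const>\<open>sum_list\<close> and its number of parts is \<^const>\<open>length\<close>.
\<close>

definition is_partition :: "nat list \<Rightarrow> bool" where
  "is_partition p \<longleftrightarrow> sorted_wrt (\<ge>) p \<and> (\<forall>a\<in>set p. 0 < a)"

definition num_parts_cong :: "nat list \<Rightarrow> nat \<Rightarrow> nat \<Rightarrow> nat" where
  "num_parts_cong p r m = length (filter (\<lambda>a. [a = r] (mod m)) p)"

definition O4 :: "nat list set" where
  "O4 = {p. is_partition p \<and> (\<forall>a\<in>set p. odd a) \<and> sorted_wrt (\<lambda>a b. a \<ge> b + 4) p}"

definition D24 :: "nat list set" where
  "D24 = {p. is_partition p \<and> distinct p \<and> (\<forall>a\<in>set p. \<not> [a = 2] (mod 4))}"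

text \<open>
  The pair \<open>(i, j)\<close> encodes the string of consecutive parts \<open>p ! i, \<dots>, p ! j\<close>,
  which is never empty.
\<close>

definition is_string4 :: "nat list \<Rightarrow> nat \<Rightarrow> nat \<Rightarrow> bool" where
  "is_string4 p i j \<longleftrightarrow>
     i \<le> j \<and> j < length p \<and> (\<forall>k. i \<le> k \<and> k < j \<longrightarrow> p ! k = p ! Suc k + 4)"

definition is_chain4 :: "nat list \<Rightarrow> nat \<Rightarrow> nat \<Rightarrow> bool" where
  "is_chain4 p i j \<longleftrightarrow> is_string4 p i j \<and>
     (\<forall>i' j'. is_string4 p i' j' \<and> i' \<le> i \<and> j \<le> j' \<longrightarrow> i' = i \<and> j' = j)"

definition num_chains :: "nat \<Rightarrow> nat list \<Rightarrow> nat" where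
  "num_chains l p = card {(i, j). is_chain4 p i j \<and> l \<le> Min ((!) p ` {i..j})}"

text \<open>The sums over partitions of a fixed \<open>n\<close> are sums over finite sets.\<close>

lemma finite_partitions: "finite {p. is_partition p \<and> sum_list p = n}"
proof (rule finite_subset)
  have "length p \<le> sum_list p" if "\<forall>a\<in>set p. 0 < a" for p :: "nat list"
    using that by (induction p) auto
  then show "{p. is_partition p \<and> sum_list p = n} \<subseteq> {p. set p \<subseteq> {..n} \<and> length p \<le> n}"
    by (auto simp: is_partition_def member_le_sum_list)
qed (simp add: finite_lists_length_le)

end

theory Submission
  imports Defs "HOL-Computational_Algebra.Formal_Power_Series"
begin

text \<open>
  Let \<open>F(w, x)\<close> be the generating function, in \<open>q\<close>, of the partitions into odd parts with gaps at least
  4, where every part carries a factor \<open>x\<close> and every chain a factor \<open>1 - w\<close>. Splitting off the least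
  part gives a linear recurrence of order three for \<open>j \<mapsto> F(w, x q\<^bsup>2j\<^esup>)\<close>, which has only one
  solution tending to 1. Uniqueness yields the contiguous relation
  \<open>F(w, x) = F(w q\<^sup>2, x) - w x q F(w q\<^sup>2, x q\<^sup>4)\<close>, which allows the chain weight to be shifted along with \<open>x\<close>.
  The left-hand side has the generating function
  \<open>S(z) = F(z\<^sup>2, z q\<^sup>4) + z q F(z\<^sup>2 q\<^sup>2, z q\<^sup>4) + z q\<^sup>3 F(z\<^sup>2 q\<^sup>2, z q\<^sup>6)\<close>, and eliminating between the
  recurrence and the contiguous relation gives \<open>S(z) = (1 + z q)(1 - z\<^sup>2 q\<^sup>4) S(z q\<^sup>2)\<close>. Iterating,
  \<open>S(z) = \<Prod>\<^sub>i (1 + z q\<^bsup>2i+1\<^esup>)(1 - z\<^sup>2 q\<^bsup>4i+4\<^esup>)\<close>, whose expansion is the right-hand side.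
\<close>

section \<open>Congruences of power series modulo powers of \<open>fps_X\<close>\<close>

lemma fps_X_power_dvd_iff:
  "fps_X ^ n dvd (f :: 'a::comm_ring_1 fps) \<longleftrightarrow> (\<forall>i<n. fps_nth f i = 0)"
proof
  assume "\<forall>i<n. fps_nth f i = 0"
  then have "f = fps_X ^ n * fps_shift n f"
    by (auto simp: fps_eq_iff fps_X_power_mult_nth)
  then show "fps_X ^ n dvd f"
    by (metis dvd_triv_left)
qed (auto simp: dvd_def fps_X_power_mult_nth)

lemma fps_eqI_X_power_dvd:
  fixes f g :: "'a::comm_ring_1 fps"
  assumes "\<And>n. fps_X ^ n dvd f - g"
  shows "f = g"
  using assms unfolding fps_X_power_dvd_iff fps_eq_iff by (metis eq_iff_diff_eq_0 fps_sub_nth lessI)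

section \<open>Linear recurrences of order three over power series\<close>

text \<open>The right-hand side of the recurrence, read as an operator on sequences, applied
  \<open>N\<close> times to the constant sequence 1.\<close>

fun rec_approx :: "(nat \<Rightarrow> 'a) \<Rightarrow> (nat \<Rightarrow> 'a) \<Rightarrow> nat \<Rightarrow> nat \<Rightarrow> 'a::comm_ring_1" where
  "rec_approx a b 0 j = 1"
| "rec_approx a b (Suc N) j = rec_approx a b N (Suc j)
     + a j * rec_approx a b N (j + 2) + b j * rec_approx a b N (j + 3)"

text \<open>The solution of the recurrence that tends to 1 as \<open>j \<rightarrow> \<infinity>\<close>: start from 1, 1, 1 far out and recur downwards.\<close>

definition rec_limit :: "(nat \<Rightarrow> 'a fps) \<Rightarrow> (nat \<Rightarrow> 'a fps) \<Rightarrow> nat \<Rightarrow> 'a::comm_ring_1 fps" where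
  "rec_limit a b j = Abs_fps (\<lambda>n. fps_nth (rec_approx a b (Suc n) j) n)"

context
  fixes a b :: "nat \<Rightarrow> 'a::comm_ring_1 fps"
  assumes ab: "\<And>j. fps_X ^ j dvd a j" "\<And>j. fps_X ^ j dvd b j"
begin

text \<open>Each application of the recurrence moves the index up by at least one, so the initial
  discrepancy \<open>a j + b j\<close> is pushed to a higher order every time.\<close>

lemma rec_approx_cauchy: "fps_X ^ (N + j) dvd rec_approx a b (Suc N) j - rec_approx a b N j"
proof (induction N arbitrary: j)
  case 0
  then show ?case using ab by simp
next
  case (Suc N)
  let ?r = "rec_approx a b"
  have "fps_X ^ (Suc N + j) dvd (?r (Suc N) (Suc j) - ?r N (Suc j))
      + a j * (?r (Suc N) (j + 2) - ?r N (j + 2)) + b j * (?r (Suc N) (j + 3) - ?r N (j + 3))"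
    by (intro dvd_add dvd_mult power_le_dvd[OF Suc]) simp_all
  also have "\<dots> = ?r (Suc (Suc N)) j - ?r (Suc N) j"
    unfolding rec_approx.simps(2)[of a b "Suc N" j] rec_approx.simps(2)[of a b N j]
    by (simp only: algebra_simps)
  finally show ?case .
qed

lemma rec_approx_nth:
  assumes "n < N"
  shows "fps_nth (rec_approx a b N j) n = fps_nth (rec_limit a b j) n"
  using assms
proof (induction N)
  case (Suc N)
  then show ?case
    using rec_approx_cauchy[of N j]
    by (cases "n = N") (auto simp: rec_limit_def fps_X_power_dvd_iff simp del: rec_approx.simps)
qed simp

lemma rec_approx_limit: "fps_X ^ N dvd rec_approx a b N j - rec_limit a b j"
  by (simp add: fps_X_power_dvd_iff rec_approx_nth)

lemma rec_limit_one: "fps_X ^ j dvd rec_limit a b j - 1"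
  unfolding fps_X_power_dvd_iff
proof (intro allI impI)
  fix i assume "i < j"
  have "fps_X ^ j dvd rec_approx a b N j - 1" for N
  proof (induction N)
    case (Suc N)
    have "fps_X ^ j dvd rec_approx a b (Suc N) j - rec_approx a b N j"
      using rec_approx_cauchy by (rule power_le_dvd) simp
    from dvd_add[OF this Suc] show ?case by (simp del: rec_approx.simps)
  qed simp
  then show "fps_nth (rec_limit a b j - 1) i = 0"
    using \<open>i < j\<close> by (simp add: fps_X_power_dvd_iff rec_limit_def del: rec_approx.simps)
qed

text \<open>The recurrence is exact between the iterates \<open>Suc N\<close> and \<open>N\<close>,
  and each of them agrees with the limit modulo \<open>fps_X ^ N\<close>.\<close>

lemma rec_limit_rec:
  "rec_limit a b j = rec_limit a b (Suc j) + a j * rec_limit a b (j + 2) + b j * rec_limit a b (j + 3)"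
proof (rule fps_eqI_X_power_dvd)
  fix N
  let ?r = "rec_approx a b" and ?l = "rec_limit a b"
  have "fps_X ^ N dvd (?r N (Suc j) - ?l (Suc j)) + a j * (?r N (j + 2) - ?l (j + 2))
      + b j * (?r N (j + 3) - ?l (j + 3)) - (?r (Suc N) j - ?l j)"
    by (intro dvd_add dvd_diff[OF _ power_le_dvd[OF rec_approx_limit[of "Suc N"]]] dvd_mult
        rec_approx_limit) simp
  also have "\<dots> = ?l j - (?l (Suc j) + a j * ?l (j + 2) + b j * ?l (j + 3))"
    by (simp add: algebra_simps)
  finally show "fps_X ^ N dvd \<dots>" .
qed

text \<open>For \<open>j >= n\<close> both sequences are 1 modulo \<open>fps_X ^ n\<close>, and the
  recurrence carries the agreement down to smaller indices.\<close>

lemma rec_unique: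
  assumes f: "\<And>j. f j = f (Suc j) + a j * f (j + 2) + b j * f (j + 3)" "\<And>j. fps_X ^ j dvd f j - 1"
    and g: "\<And>j. g j = g (Suc j) + a j * g (j + 2) + b j * g (j + 3)" "\<And>j. fps_X ^ j dvd g j - 1"
  shows "f j = g j"
proof (rule fps_eqI_X_power_dvd)
  fix n
  have "fps_X ^ n dvd f j - g j" if "n \<le> j + k" for j k
    using that
  proof (induction k arbitrary: j rule: less_induct)
    case (less k)
    show ?case
    proof (cases "n \<le> j")
      case True
      have "fps_X ^ n dvd (f j - 1) - (g j - 1)"
        by (intro dvd_diff power_le_dvd[OF f(2) True] power_le_dvd[OF g(2) True])
      then show ?thesis by simp
    next
      case False
      \<comment> \<open>\<open>k\<close> bounds how far \<open>j\<close> lies below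
        \<open>n\<close>. For \<open>i > k\<close> the index \<open>j + i\<close> is already beyond
        \<open>n\<close>, which is the case of distance 0.\<close>
      have IH: "fps_X ^ n dvd f (j + i) - g (j + i)" if "0 < i" for i
        using less.IH[of "k - i" "j + i"] less.IH[of 0 "j + i"] less.prems False that
        by (cases "i \<le> k") auto
      have "fps_X ^ n dvd (f (j + 1) - g (j + 1)) + a j * (f (j + 2) - g (j + 2))
          + b j * (f (j + 3) - g (j + 3))"
        by (intro dvd_add dvd_mult IH) auto
      also have "\<dots> = f j - g j"
        by (subst f(1)[of j], subst g(1)[of j]) (simp add: algebra_simps)
      finally show ?thesis .
    qed
  qed
  from this[of j n] show "fps_X ^ n dvd f j - g j" by simp
qed

end

section \<open>The functional equation\<close>

definition part_term :: "'a::comm_ring_1 \<Rightarrow> nat \<Rightarrow> 'a fps" where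
  "part_term z j = fps_const z * fps_X ^ (2 * j + 1)"

text \<open>
  In the notation of the header this is \<open>F(w, x)\<close> at \<open>w = z\<^sup>2 q\<^bsup>2i\<^esup>\<close> and \<open>x = z q\<^bsup>2j\<^esup>\<close>:
  only the parameter of the chain weight moves with \<open>i\<close>, only the lower bound \<open>2j + 1\<close> of the parts with \<open>j\<close>.
\<close>

definition chain_gf :: "'a::comm_ring_1 \<Rightarrow> nat \<Rightarrow> nat \<Rightarrow> 'a fps" where
  "chain_gf z i = rec_limit (part_term z) (\<lambda>j. - (fps_const (z\<^sup>2) * fps_X ^ (2 * i)) * part_term z j)"

lemma X_power_dvd_part_term: "n \<le> 2 * j + 1 \<Longrightarrow> fps_X ^ n dvd part_term z j"
  unfolding part_term_def by (intro dvd_mult le_imp_power_dvd)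

lemma part_term_add: "part_term z (j + k) = fps_X ^ (2 * k) * part_term z j"
  by (simp add: part_term_def algebra_simps flip: power_add)

text \<open>Let \<open>w\<close> be the chain parameter, \<open>F\<close> this series and
  \<open>E j\<close> the part with least index \<open>j\<close> and first chain unweighted. Then
  \<open>F j = F (j + 1) + (1 - w) * E j\<close> and
  \<open>E j = part_term z j * (F (j + 3) + E (j + 2))\<close>; eliminating \<open>E\<close> gives
  the recurrence.\<close>

lemma chain_gf_rec:
  "chain_gf z i j = chain_gf z i (Suc j) + part_term z j *
     (chain_gf z i (j + 2) - fps_const (z\<^sup>2) * fps_X ^ (2 * i) * chain_gf z i (j + 3))"
  unfolding chain_gf_def
  by (subst rec_limit_rec) (simp_all add: X_power_dvd_part_term algebra_simps dvd_mult)

lemma chain_gf_one: "fps_X ^ j dvd chain_gf z i j - 1"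
  unfolding chain_gf_def
  by (rule rec_limit_one) (simp_all add: X_power_dvd_part_term dvd_mult)

text \<open>
  The right-hand side satisfies the recurrence of the left-hand side, so uniqueness gives the first
  equation; the second one is found on the way.
\<close>

lemma chain_gf_shift:
  "chain_gf z i j = chain_gf z (Suc i) j
     - fps_const (z\<^sup>2) * fps_X ^ (2 * i) * part_term z j * chain_gf z (Suc i) (j + 2)"
  (is "_ = ?h j")
  and chain_gf_shift_Suc:
  "chain_gf z i (Suc j) = chain_gf z (Suc i) j - part_term z j * chain_gf z (Suc i) (j + 2)"
proof -
  define w where "w = fps_const (z\<^sup>2) * fps_X ^ (2 * i)"
  define g t where "g = chain_gf z (Suc i)" and "t = part_term z"
  define h where "h j = g j - w * t j * g (j + 2)" for j
  \<comment> \<open>Moving the part up by one index and raising the chain parameter by one both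
    contribute \<open>fps_X ^ 2\<close>, so the recurrence of \<open>g\<close> absorbs the term with
    \<open>g (j + 3)\<close>.\<close>
  have h_Suc: "h (Suc j) = g j - t j * g (j + 2)" for j
    using chain_gf_rec[of z "Suc i" j] part_term_add[of z j 1]
    by (simp add: h_def g_def w_def t_def algebra_simps eval_nat_numeral)
  have rec: "h j = h (Suc j) + t j * (h (j + 2) - w * h (j + 3))" for j
  proof -
    have A: "h (j + 3) = g (j + 2) - t (j + 2) * g (j + 2 + 2)"
      using h_Suc[of "j + 2"] by (simp add: eval_nat_numeral)
    \<comment> \<open>The terms with \<open>g (j + 4)\<close> cancel.\<close>
    have "h (j + 2) - w * h (j + 3) = (1 - w) * g (j + 2)"
      by (simp only: A h_def[of "j + 2"]) (simp add: algebra_simps)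
    then show ?thesis
      by (simp only: h_Suc) (simp add: h_def[of j] algebra_simps)
  qed
  have one: "fps_X ^ j dvd h j - 1" for j
  proof -
    have "fps_X ^ j dvd (g j - 1) - w * t j * g (j + 2)"
      unfolding g_def t_def
      by (intro dvd_diff chain_gf_one dvd_mult2 dvd_mult X_power_dvd_part_term) simp
    then show ?thesis by (simp add: h_def algebra_simps)
  qed
  have eq: "chain_gf z i j = h j" for j
  proof (rule rec_unique[where a = t and b = "\<lambda>j. - w * t j"])
    show "fps_X ^ j dvd t j" "fps_X ^ j dvd - w * t j" for j
      by (simp_all add: t_def X_power_dvd_part_term dvd_mult)
    show "chain_gf z i j = chain_gf z i (Suc j) + t j * chain_gf z i (j + 2)
        + - w * t j * chain_gf z i (j + 3)" for j
      by (subst chain_gf_rec) (simp add: algebra_simps w_def t_def)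
    show "h j = h (Suc j) + t j * h (j + 2) + - w * t j * h (j + 3)" for j
      by (subst rec) (simp add: algebra_simps)
  qed (fact chain_gf_one one)+
  show "chain_gf z i j = ?h j"
    using eq by (simp add: h_def g_def w_def t_def)
  show "chain_gf z i (Suc j) = chain_gf z (Suc i) j - part_term z j * chain_gf z (Suc i) (j + 2)"
    using eq[of "Suc j"] by (simp add: h_Suc) (simp add: g_def t_def)
qed

text \<open>
  \<open>S(z q\<^bsup>2i\<^esup>)\<close>: the three terms collect the partitions with least part at least 5, equal to 1 and
  equal to 3, the last two with their first chain unweighted.
\<close>

definition o4_gf :: "'a::comm_ring_1 \<Rightarrow> nat \<Rightarrow> 'a fps" where
  "o4_gf z i = chain_gf z (2 * i) (i + 2) + part_term z i * chain_gf z (2 * i + 1) (i + 2)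
     + part_term z (i + 1) * chain_gf z (2 * i + 1) (i + 3)"

text \<open>
  Here \<open>T = z q\<^bsup>2i+1\<^esup>\<close>, \<open>r = q\<^sup>2\<close>, and the letters f, h, g, u stand for the values of \<^const>\<open>chain_gf\<close>
  at the four consecutive chain parameters between \<open>2i\<close> and \<open>2i + 3\<close>; everything is expressed in u4, u5, u6.
\<close>

lemma elimination_identity:
  fixes T r :: "'a::comm_ring_1"
  assumes f2: "f2 = h2 - T^3*r*h4"
    and h: "h2 = g2 - T^3*r^2*g4" "h3 = g3 - T^3*r^3*g5" "h4 = g3 - T*r^3*g5"
    and g2: "g2 = g3 + T*r^2*(g4 - T^2*r*g5)"
    and g: "g3 = u3 - T^3*r^4*u5" "g4 = u3 - T*r^3*u5" "g5 = u4 - T*r^4*u6"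
    and u3: "u3 = u4 + T*r^3*(u5 - T^2*r^2*u6)"
  shows "f2 + T*h2 + T*r*h3 = (1 + T) * (1 - T^2*r) * (g3 + T*r*u3 + T*r^2*u4)"
proof -
  \<comment> \<open>The two factors come out one at a time: \<open>1 + T\<close> once
    \<open>g2\<close> is eliminated, \<open>1 - T^2*r\<close> only after passing to the
    \<open>u\<close> level.\<close>
  have "f2 + T*h2 + T*r*h3
      = (1 + T) * ((1 + T*r - T^2*r) * g3 + (T*r^2 - T^3*r^2) * g4 - T^3*r^3*g5)"
    unfolding f2 h g2 by (simp add: algebra_simps power2_eq_square power3_eq_cube)
  also have "(1 + T*r - T^2*r) * g3 + (T*r^2 - T^3*r^2) * g4 - T^3*r^3*g5
      = (1 - T^2*r) * (g3 + T*r*u3 + T*r^2*u4)"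
    unfolding g u3 by (simp add: algebra_simps power2_eq_square power3_eq_cube power4_eq_xxxx)
  finally show ?thesis by (simp only: mult.assoc)
qed

lemma o4_gf_step:
  "o4_gf z i = (1 + part_term z i) * (1 - fps_const (z\<^sup>2) * fps_X ^ (4 * i + 4)) * o4_gf z (Suc i)"
proof -
  define T where "T = part_term z i"
  define r where "r = (fps_X\<^sup>2 :: 'a fps)"
  have t: "part_term z (i + k) = T * r ^ k" for k
    by (simp add: part_term_add T_def r_def mult.commute flip: power_mult)
  define c where "c = fps_const (z\<^sup>2) * fps_X ^ (2 * (2 * i))"
  have "T\<^sup>2 = fps_const (z\<^sup>2) * fps_X ^ ((2 * i + 1) * 2)"
    by (simp only: T_def part_term_def power_mult_distrib fps_const_power power_mult)
  also have "(2 * i + 1) * 2 = 2 * (2 * i) + 2"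
    by simp
  finally have c: "c * r = T\<^sup>2"
    by (simp only: c_def r_def power_add mult.assoc)
  have T2: "fps_const (z\<^sup>2) * fps_X ^ (2 * (2 * i + (k + 1))) = T\<^sup>2 * r ^ k" for k
  proof -
    have "2 * (2 * i + (k + 1)) = 2 * (2 * i) + 2 + 2 * k"
      by simp
    then have "fps_const (z\<^sup>2) * fps_X ^ (2 * (2 * i + (k + 1))) = c * r * fps_X ^ (2 * k)"
      by (simp only: c_def r_def power_add mult.assoc)
    then show ?thesis
      unfolding c by (simp only: r_def power_mult)
  qed
  have T3: "T\<^sup>2 * r ^ m * (T * r ^ n) = T ^ 3 * r ^ (m + n)" for m n
    by (simp only: power_add power2_eq_square power3_eq_cube mult.assoc mult.left_commute)
  \<comment> \<open>Row \<open>k\<close> = 0, 1, 2, 3 corresponds to the letters f, h, g, u of the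
    elimination.\<close>
  let ?F = "\<lambda>k j. chain_gf z (2 * i + k) (i + j)"
  have s: "?F (k + 1) j = ?F (k + 2) j - T ^ 3 * r ^ (k + j) * ?F (k + 2) (j + 2)" for k j
    using chain_gf_shift[of z "2 * i + (k + 1)" "i + j"] unfolding T2 t T3 by (simp add: add.assoc)
  have s': "?F k (j + 1) = ?F (k + 1) j - T * r ^ j * ?F (k + 1) (j + 2)" for k j
    using chain_gf_shift_Suc[of z "2 * i + k" "i + j"] unfolding t by (simp add: add.assoc)
  have rec: "?F (k + 1) j = ?F (k + 1) (j + 1)
      + T * r ^ j * (?F (k + 1) (j + 2) - T\<^sup>2 * r ^ k * ?F (k + 1) (j + 3))" for k j
    using chain_gf_rec[of z "2 * i + (k + 1)" "i + j"] unfolding T2 t by (simp add: add.assoc)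
  \<comment> \<open>The weight at chain parameter \<open>2 * i\<close> is formally
    \<open>T^2 / r\<close>, no polynomial in \<open>T\<close> and \<open>r\<close>; the factor
    \<open>r^2\<close> of the part with index \<open>i + 2\<close> absorbs the denominator.\<close>
  have s0: "?F 0 2 = ?F 1 2 - T ^ 3 * r * ?F 1 4"
  proof -
    have "c * (T * r\<^sup>2) = c * r * (T * r)"
      by (simp only: power2_eq_square ac_simps)
    then have "fps_const (z\<^sup>2) * fps_X ^ (2 * (2 * i)) * (T * r\<^sup>2) = T ^ 3 * r"
      unfolding c by (simp only: c_def power2_eq_square power3_eq_cube mult.assoc)
    then show ?thesis
      using chain_gf_shift[of z "2 * i" "i + 2"] unfolding t add.assoc by simp
  qed
  have e1: "?F 1 2 = ?F 2 2 - T ^ 3 * r\<^sup>2 * ?F 2 4"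
    using s[of 0 2] by (simp add: power2_eq_square)
  have e2: "?F 1 3 = ?F 2 3 - T ^ 3 * r ^ 3 * ?F 2 5"
    using s[of 0 3] by simp
  have e3: "?F 1 4 = ?F 2 3 - T * r ^ 3 * ?F 2 5"
    using s'[of 1 3] by simp
  have e4: "?F 2 2 = ?F 2 3 + T * r\<^sup>2 * (?F 2 4 - T\<^sup>2 * r * ?F 2 5)"
    using rec[of 1 2] by simp
  have e5: "?F 2 3 = ?F 3 3 - T ^ 3 * r ^ 4 * ?F 3 5"
    using s[of 1 3] by (simp add: eval_nat_numeral)
  have e6: "?F 2 4 = ?F 3 3 - T * r ^ 3 * ?F 3 5"
    using s'[of 2 3] by (simp add: eval_nat_numeral)
  have e7: "?F 2 5 = ?F 3 4 - T * r ^ 4 * ?F 3 6"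
    using s'[of 2 4] by (simp add: eval_nat_numeral)
  have e8: "?F 3 3 = ?F 3 4 + T * r ^ 3 * (?F 3 5 - T\<^sup>2 * r\<^sup>2 * ?F 3 6)"
    using rec[of 2 3] by (simp add: eval_nat_numeral)
  have "?F 0 2 + T * ?F 1 2 + T * r * ?F 1 3
      = (1 + T) * (1 - T\<^sup>2 * r) * (?F 2 3 + T * r * ?F 3 3 + T * r\<^sup>2 * ?F 3 4)"
    by (rule elimination_identity[OF s0 e1 e2 e3 e4 e5 e6 e7 e8])
  moreover have "T\<^sup>2 * r = fps_const (z\<^sup>2) * fps_X ^ (4 * i + 4)"
  proof -
    have "2 * (2 * i + (1 + 1)) = 4 * i + 4"
      by simp
    then show ?thesis
      using T2[of 1] by (simp only: power_one_right)
  qed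
  moreover have "o4_gf z i = ?F 0 2 + T * ?F 1 2 + T * r * ?F 1 3"
    using t[of 1] by (simp add: o4_gf_def T_def)
  moreover have "o4_gf z (Suc i) = ?F 2 3 + T * r * ?F 3 3 + T * r\<^sup>2 * ?F 3 4"
    using t[of 1] t[of 2] unfolding o4_gf_def by (simp add: eval_nat_numeral)
  ultimately show ?thesis
    by (simp only: T_def)
qed

lemma o4_gf_one: "fps_X ^ i dvd o4_gf z i - 1"
proof -
  have "fps_X ^ i dvd (chain_gf z (2 * i) (i + 2) - 1) + part_term z i * chain_gf z (2 * i + 1) (i + 2)
     + part_term z (i + 1) * chain_gf z (2 * i + 1) (i + 3)"
    by (intro dvd_add dvd_mult2 X_power_dvd_part_term power_le_dvd[OF chain_gf_one]) auto
  then show ?thesis by (simp add: o4_gf_def algebra_simps)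
qed

lemma o4_gf_prod:
  "o4_gf z 0 = (\<Prod>i<m. (1 + part_term z i) * (1 - fps_const (z\<^sup>2) * fps_X ^ (4 * i + 4))) * o4_gf z m"
proof (induction m)
  case (Suc m)
  show ?case
    unfolding Suc o4_gf_step[of z m] by (simp only: prod.lessThan_Suc mult.assoc)
qed simp

section \<open>Partitions with gaps as index sets\<close>

text \<open>The index \<open>i\<close> encodes the odd part \<open>2i + 1\<close>, so a gap of 4 between parts is a gap of 2 between indices.\<close>

definition gapped :: "nat \<Rightarrow> nat \<Rightarrow> nat set set" where
  "gapped j M = {A. A \<subseteq> {j..<M} \<and> (\<forall>i\<in>A. Suc i \<notin> A)}"

definition gapped_from :: "nat \<Rightarrow> nat \<Rightarrow> nat set set" where
  "gapped_from j M = {A \<in> gapped j M. j \<in> A}"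

text \<open>An index \<open>i\<close> in this set encodes the chain with least part \<open>2(i + 2) + 1\<close>; for \<open>j = 0\<close> the bound on it is 5.\<close>

definition chain_starts :: "nat \<Rightarrow> nat set \<Rightarrow> nat set" where
  "chain_starts j A = {i. j \<le> i \<and> i \<notin> A \<and> i + 2 \<in> A}"

definition gap_weight :: "'a::comm_ring_1 \<Rightarrow> nat \<Rightarrow> nat set \<Rightarrow> 'a fps" where
  "gap_weight z j A = (\<Prod>i\<in>A. part_term z i) * fps_const (1 - z\<^sup>2) ^ card (chain_starts j A)"

text \<open>The chain containing the least part \<open>2j + 1\<close> carries no weight here.\<close>

definition first_gf :: "'a::comm_ring_1 \<Rightarrow> nat \<Rightarrow> nat \<Rightarrow> 'a fps" where
  "first_gf z M j = (\<Sum>A\<in>gapped_from j M. gap_weight z j A)"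

lemma finite_gapped: "finite (gapped j M)"
  by (rule finite_subset[of _ "Pow {j..<M}"]) (auto simp: gapped_def)

lemma finite_gapped_from: "finite (gapped_from j M)"
  unfolding gapped_from_def using finite_gapped by auto

lemma gapped_from_empty: "M \<le> j \<Longrightarrow> gapped_from j M = {}"
  by (auto simp: gapped_from_def gapped_def)

lemma gapped_decomp: "gapped j M = insert {} (\<Union>i\<in>{j..<M}. gapped_from i M)"
proof (intro equalityI subsetI)
  fix A assume A: "A \<in> gapped j M"
  show "A \<in> insert {} (\<Union>i\<in>{j..<M}. gapped_from i M)"
  proof (cases "A = {}")
    case False
    have "finite A" using A by (auto simp: gapped_def intro: finite_subset)
    then have "Min A \<in> A" "\<And>i. i \<in> A \<Longrightarrow> Min A \<le> i"
      using False by auto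
    then have "A \<in> gapped_from (Min A) M" "Min A \<in> {j..<M}"
      using A by (auto simp: gapped_def gapped_from_def)
    then show ?thesis by blast
  qed simp
qed (auto simp: gapped_def gapped_from_def)

lemma sum_gapped:
  "(\<Sum>A\<in>gapped j M. f A) = f {} + (\<Sum>i=j..<M. \<Sum>A\<in>gapped_from i M. f A)"
proof -
  have "gapped_from i M \<inter> gapped_from i' M = {}" if "i \<noteq> i'" for i i'
    using that by (cases i i' rule: linorder_cases) (auto simp: gapped_from_def gapped_def)
  moreover have "{} \<notin> (\<Union>i\<in>{j..<M}. gapped_from i M)"
    by (auto simp: gapped_from_def)
  ultimately show ?thesis
    unfolding gapped_decomp by (simp add: finite_gapped_from sum.UNION_disjoint)
qed

text \<open>Lowering the bound from the least index \<open>i\<close> to \<open>j\<close> can expose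
  only the chain starting at \<open>i\<close> itself, whose code is \<open>i - 2\<close>.\<close>

lemma chain_starts_gapped_from:
  assumes "A \<in> gapped_from i M" "j \<le> i"
  shows "chain_starts j A = (if j + 2 \<le> i then insert (i - 2) (chain_starts i A) else chain_starts i A)"
proof -
  have "i \<in> A" "Suc i \<notin> A" and ge: "\<And>l. l \<in> A \<Longrightarrow> i \<le> l"
    using assms(1) by (auto simp: gapped_from_def gapped_def)
  have *: "l \<ge> i \<or> l = i - 2 \<and> 2 \<le> i" if "l + 2 \<in> A" for l
  proof -
    have "i \<le> l + 2" using ge[OF that] .
    moreover have "l + 2 \<noteq> Suc i" using that \<open>Suc i \<notin> A\<close> by metis
    ultimately show ?thesis by linarith
  qed
  have "l \<in> chain_starts j A \<longleftrightarrow> l \<in> chain_starts i A \<or> l = i - 2 \<and> j + 2 \<le> i" for l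
  proof (cases "l = i - 2 \<and> j + 2 \<le> i")
    case True
    then have "l + 2 = i" "l < i" by auto
    moreover from this have "l \<notin> A" using ge[of l] by auto
    ultimately show ?thesis using \<open>i \<in> A\<close> True by (auto simp: chain_starts_def)
  next
    case False
    with * assms(2) show ?thesis
      unfolding chain_starts_def mem_Collect_eq
      by (metis add_leD1 le_diff_conv2 le_trans)
  qed
  then show ?thesis by auto
qed

lemma finite_chain_starts:
  assumes "finite A"
  shows "finite (chain_starts j A)"
proof (rule finite_subset)
  show "chain_starts j A \<subseteq> (\<lambda>i. i - 2) ` A"
    by (auto simp: chain_starts_def intro!: image_eqI[of _ _ "_ + 2"])
qed (use assms in simp)

lemma gapped_finite_elem: "A \<in> gapped j M \<Longrightarrow> finite A"
  by (auto simp: gapped_def intro: finite_subset)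

lemma gap_weight_gapped_from:
  assumes "A \<in> gapped_from i M" "j \<le> i"
  shows "gap_weight z j A = (if j + 2 \<le> i then fps_const (1 - z\<^sup>2) else 1) * gap_weight z i A"
proof -
  have "finite (chain_starts i A)"
    using assms by (auto simp: gapped_from_def intro: finite_chain_starts gapped_finite_elem)
  moreover have "i - 2 \<notin> chain_starts i A" if "2 \<le> i"
    using that by (auto simp: chain_starts_def)
  ultimately show ?thesis
    by (simp add: gap_weight_def chain_starts_gapped_from[OF assms] mult_ac)
qed

lemma gapped_from_insert:
  assumes "j < M"
  shows "gapped_from j M = insert j ` gapped (j + 2) M"
proof (intro equalityI subsetI)
  fix A assume A: "A \<in> gapped_from j M"
  have "l \<in> {j + 2..<M}" if "l \<in> A" "l \<noteq> j" for l
  proof -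
    have "l \<in> {j..<M}" "l \<noteq> Suc j"
      using A that by (auto simp: gapped_from_def gapped_def)
    with that show ?thesis by auto
  qed
  then have "A - {j} \<subseteq> {j + 2..<M}" by blast
  with A have "A - {j} \<in> gapped (j + 2) M"
    by (auto simp: gapped_from_def gapped_def)
  moreover have "A = insert j (A - {j})"
    using A by (auto simp: gapped_from_def)
  ultimately show "A \<in> insert j ` gapped (j + 2) M" by blast
next
  fix A assume "A \<in> insert j ` gapped (j + 2) M"
  then show "A \<in> gapped_from j M"
    using assms by (force simp: gapped_from_def gapped_def)
qed

text \<open>The index \<open>j + 2\<close>, if present, continues the chain of \<open>j\<close>
  instead of starting one; hence the bound \<open>j + 1\<close>.\<close>

lemma gap_weight_insert:
  assumes "A \<in> gapped (j + 2) M"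
  shows "gap_weight z j (insert j A) = part_term z j *
    ((\<Prod>i\<in>A. part_term z i) * fps_const (1 - z\<^sup>2) ^ card (chain_starts (j + 1) A))"
proof -
  have "j \<notin> A" "finite A"
    using assms gapped_finite_elem by (auto simp: gapped_def)
  moreover have "chain_starts j (insert j A) = chain_starts (j + 1) A"
    using assms by (auto simp: chain_starts_def gapped_def)
  ultimately show ?thesis
    by (simp add: gap_weight_def)
qed

section \<open>Recurrences for the truncated generating functions\<close>

text \<open>Case split on the next index: none, \<open>j + 2\<close>, which continues the unweighted
  first chain, or at least \<open>j + 3\<close>, which opens a weighted chain.\<close>

lemma first_gf_rec:
  assumes "j < M"
  shows "first_gf z M j = part_term z j *
    (1 + first_gf z M (j + 2) + fps_const (1 - z\<^sup>2) * (\<Sum>i=j+3..<M. first_gf z M i))"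
proof -
  have "inj_on (insert j) (gapped (j + 2) M)"
  proof (rule inj_onI)
    fix A B assume "A \<in> gapped (j + 2) M" "B \<in> gapped (j + 2) M" "insert j A = insert j B"
    moreover from this have "j \<notin> A" "j \<notin> B"
      by (auto simp: gapped_def)
    ultimately show "A = B" by (simp add: insert_ident)
  qed
  then have "first_gf z M j = (\<Sum>A\<in>gapped (j + 2) M. gap_weight z j (insert j A))"
    unfolding first_gf_def gapped_from_insert[OF assms] by (simp add: sum.reindex)
  also have "\<dots> = part_term z j * (\<Sum>A\<in>gapped (j + 2) M. gap_weight z (j + 1) A)"
    unfolding sum_distrib_left
    by (rule sum.cong[OF refl]) (simp only: gap_weight_insert, simp add: gap_weight_def)
  also have "(\<Sum>A\<in>gapped (j + 2) M. gap_weight z (j + 1) A)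
      = 1 + (\<Sum>i=j+2..<M. \<Sum>A\<in>gapped_from i M. gap_weight z (j + 1) A)"
    unfolding sum_gapped by (simp add: gap_weight_def chain_starts_def)
  also have "(\<Sum>i=j+2..<M. \<Sum>A\<in>gapped_from i M. gap_weight z (j + 1) A)
      = (\<Sum>i=j+2..<M. (if i = j + 2 then 1 else fps_const (1 - z\<^sup>2)) * first_gf z M i)"
    unfolding first_gf_def sum_distrib_left
    by (intro sum.cong refl) (subst gap_weight_gapped_from, auto)
  also have "\<dots> = first_gf z M (j + 2) + fps_const (1 - z\<^sup>2) * (\<Sum>i=j+3..<M. first_gf z M i)"
  proof (cases "j + 2 < M")
    case True
    have "(\<Sum>i=j+3..<M. (if i = j + 2 then 1 else fps_const (1 - z\<^sup>2)) * first_gf z M i)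
        = (\<Sum>i=j+3..<M. fps_const (1 - z\<^sup>2) * first_gf z M i)"
      by (intro sum.cong) auto
    moreover have "{j + 2..<M} = insert (j + 2) {j + 3..<M}"
      using True by auto
    ultimately show ?thesis
      by (simp add: sum_distrib_left)
  next
    case False
    then show ?thesis by (simp add: first_gf_def gapped_from_empty)
  qed
  finally show ?thesis by (simp add: add.assoc)
qed

text \<open>The truncated sums obey the same recurrences as the series, and for
  \<open>j >= M\<close> both claims are trivial modulo \<open>fps_X ^ M\<close>. Descending
  induction treats them together because each feeds the other.\<close>

lemma X_power_dvd_first_gf_diff:
  "fps_X ^ M dvd part_term z j * chain_gf z 1 (j + 2) - first_gf z M j"
  and X_power_dvd_tail_diff:
  "fps_X ^ M dvd chain_gf z 0 j - (1 + fps_const (1 - z\<^sup>2) * (\<Sum>i=j..<M. first_gf z M i))"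
proof -
  define e where "e j = part_term z j * chain_gf z 1 (j + 2)" for j
  define u where "u = fps_const (1 - z\<^sup>2)"
  define tail where "tail j = 1 + u * (\<Sum>i=j..<M. first_gf z M i)" for j
  have u: "u = 1 - fps_const (z\<^sup>2)"
    by (simp add: u_def flip: fps_const_sub)
  \<comment> \<open>The difference of the two contiguous relations yields the series with unweighted
    first chain without a division by \<open>1 - z^2\<close>.\<close>
  have F: "chain_gf z 0 j = chain_gf z 0 (Suc j) + u * e j" for j
    using chain_gf_shift[of z 0 j] chain_gf_shift_Suc[of z 0 j]
    by (simp add: u e_def algebra_simps)
  have e: "e j = part_term z j * (chain_gf z 0 (j + 3) + e (j + 2))" for j
    using chain_gf_shift_Suc[of z 0 "j + 2"] by (simp add: e_def numeral_3_eq_3)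
  have "fps_X ^ M dvd e j - first_gf z M j \<and> fps_X ^ M dvd chain_gf z 0 j - tail j" if "M \<le> j + k" for j k
    using that
  proof (induction k arbitrary: j rule: less_induct)
    case (less k)
    show ?case
    proof (cases "M \<le> j")
      case True
      have "fps_X ^ M dvd e j"
        unfolding e_def using True by (intro dvd_mult2 X_power_dvd_part_term) simp
      with True show ?thesis
        using power_le_dvd[OF chain_gf_one True] by (simp add: first_gf_def gapped_from_empty tail_def)
    next
      case False
      have IH: "fps_X ^ M dvd e (j + i) - first_gf z M (j + i)"
        "fps_X ^ M dvd chain_gf z 0 (j + i) - tail (j + i)" if "0 < i" for i
        using less.IH[of "k - i" "j + i"] less.IH[of 0 "j + i"] less.prems False that
        by (cases "i \<le> k"; auto)+
      have "fps_X ^ M dvd part_term z j * ((chain_gf z 0 (j + 3) - tail (j + 3))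
          + (e (j + 2) - first_gf z M (j + 2)))"
        by (intro dvd_mult dvd_add IH) auto
      also have "\<dots> = e j - first_gf z M j"
        using False by (subst e, subst first_gf_rec) (simp_all add: tail_def u_def algebra_simps)
      finally have 1: "fps_X ^ M dvd e j - first_gf z M j" .
      have "fps_X ^ M dvd (chain_gf z 0 (j + 1) - tail (j + 1)) + u * (e j - first_gf z M j)"
        by (intro dvd_add dvd_mult IH 1) auto
      also have "\<dots> = chain_gf z 0 j - tail j"
        using False by (subst F) (simp add: tail_def sum.atLeast_Suc_lessThan algebra_simps)
      finally show ?thesis using 1 by simp
    qed
  qed
  from this[of j M]
  show "fps_X ^ M dvd part_term z j * chain_gf z 1 (j + 2) - first_gf z M j"
    and "fps_X ^ M dvd chain_gf z 0 j - (1 + fps_const (1 - z\<^sup>2) * (\<Sum>i=j..<M. first_gf z M i))"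
    by (simp_all add: e_def tail_def u_def)
qed

text \<open>Least indices 0 and 1 are the parts 1 and 3, whose chain lies below the bound 5 and has
  no weight; from index 2 on the first chain counts.\<close>

lemma X_power_dvd_o4_gf_diff:
  assumes "2 \<le> M"
  shows "fps_X ^ M dvd o4_gf z 0 - (\<Sum>A\<in>gapped 0 M. gap_weight z 0 A)"
proof -
  have "(\<Sum>A\<in>gapped 0 M. gap_weight z 0 A)
      = 1 + (\<Sum>i=0..<M. \<Sum>A\<in>gapped_from i M. gap_weight z 0 A)"
    unfolding sum_gapped by (simp add: gap_weight_def chain_starts_def)
  also have "(\<Sum>i=0..<M. \<Sum>A\<in>gapped_from i M. gap_weight z 0 A)
      = (\<Sum>i=0..<M. (if i < 2 then 1 else fps_const (1 - z\<^sup>2)) * first_gf z M i)"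
    unfolding first_gf_def sum_distrib_left
    by (intro sum.cong refl) (subst gap_weight_gapped_from, auto)
  also have "\<dots> = first_gf z M 0 + first_gf z M 1
      + (\<Sum>i=2..<M. (if i < 2 then 1 else fps_const (1 - z\<^sup>2)) * first_gf z M i)"
    using assms by (simp add: sum.atLeast_Suc_lessThan numeral_2_eq_2 add.assoc)
  also have "(\<Sum>i=2..<M. (if i < 2 then 1 else fps_const (1 - z\<^sup>2)) * first_gf z M i)
      = fps_const (1 - z\<^sup>2) * (\<Sum>i=2..<M. first_gf z M i)"
    unfolding sum_distrib_left by (intro sum.cong) auto
  finally have *: "(\<Sum>A\<in>gapped 0 M. gap_weight z 0 A) = 1 + (first_gf z M 0 + first_gf z M 1
      + fps_const (1 - z\<^sup>2) * (\<Sum>i=2..<M. first_gf z M i))" .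
  have "fps_X ^ M dvd (chain_gf z 0 2 - (1 + fps_const (1 - z\<^sup>2) * (\<Sum>i=2..<M. first_gf z M i)))
      + (part_term z 0 * chain_gf z 1 (0 + 2) - first_gf z M 0)
      + (part_term z 1 * chain_gf z 1 (1 + 2) - first_gf z M 1)"
    by (intro dvd_add X_power_dvd_first_gf_diff X_power_dvd_tail_diff)
  also have "\<dots> = o4_gf z 0 - (\<Sum>A\<in>gapped 0 M. gap_weight z 0 A)"
    unfolding * by (simp add: o4_gf_def numeral_2_eq_2 numeral_3_eq_3 algebra_simps)
  finally show ?thesis .
qed

section \<open>From lists to sets\<close>

lemma sorted_wrt_total:
  assumes "sorted_wrt R xs" "x \<in> set xs" "y \<in> set xs" "x \<noteq> y"
  shows "R x y \<or> R y x"
proof -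
  obtain i j where "i < length xs" "x = xs ! i" "j < length xs" "y = xs ! j"
    using assms by (auto simp: in_set_conv_nth)
  then show ?thesis
    using assms(1,4) by (cases i j rule: linorder_cases) (auto simp: sorted_wrt_iff_nth_less)
qed

definition desc_list :: "nat set \<Rightarrow> nat list" where
  "desc_list B = rev (sorted_list_of_set B)"

lemma sorted_desc_list: "sorted_wrt (>) (desc_list B)"
  by (simp add: desc_list_def sorted_wrt_rev)

lemma set_desc_list: "finite B \<Longrightarrow> set (desc_list B) = B"
  by (simp add: desc_list_def)

lemma desc_list_set:
  assumes "sorted_wrt (>) p"
  shows "desc_list (set p) = p"
proof -
  have "sorted_wrt (<) (rev p)"
    using assms by (simp add: sorted_wrt_rev)
  then have "sorted_list_of_set (set (rev p)) = rev p"
    using strict_sorted_iff[of "rev p"] by (intro sorted_list_of_set.idem_if_sorted_distinct) simp_all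
  then show ?thesis by (simp add: desc_list_def)
qed

lemma sorted_gt_distinct: "sorted_wrt (>) (p :: nat list) \<Longrightarrow> distinct p"
  by (induction p) auto

text \<open>Distinct odd parts differ by even amounts, so a gap of at least 4 only forbids the
  difference 2.\<close>

lemma O4_iff:
  "p \<in> O4 \<longleftrightarrow> sorted_wrt (>) p \<and> (\<forall>a\<in>set p. odd a \<and> a + 2 \<notin> set p)"
proof
  assume "p \<in> O4"
  then have s: "sorted_wrt (\<lambda>a b. a \<ge> b + 4) p" and "\<forall>a\<in>set p. odd a"
    by (auto simp: O4_def)
  moreover have "a + 2 \<notin> set p" if "a \<in> set p" for a
    using sorted_wrt_total[OF s that, of "a + 2"] by auto
  moreover have "sorted_wrt (>) p"
    using s by (rule sorted_wrt_mono_rel[rotated]) auto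
  ultimately show "sorted_wrt (>) p \<and> (\<forall>a\<in>set p. odd a \<and> a + 2 \<notin> set p)"
    by blast
next
  assume p: "sorted_wrt (>) p \<and> (\<forall>a\<in>set p. odd a \<and> a + 2 \<notin> set p)"
  have gap: "x \<ge> y + 4" if "x \<in> set p" "y \<in> set p" "x > y" for x y
  proof -
    have "odd x" "odd y" "x \<noteq> y + 2"
      using p that by auto
    with \<open>x > y\<close> show ?thesis by presburger
  qed
  have "sorted_wrt (\<lambda>a b. a \<ge> b + 4) p"
    by (rule sorted_wrt_mono_rel[where P = "(>)"]) (use p gap in blast)+
  moreover have "sorted_wrt (\<ge>) p"
    by (rule sorted_wrt_mono_rel[where P = "(>)"]) (use p in auto)
  moreover have "\<forall>a\<in>set p. 0 < a"
    using p by (simp add: odd_pos)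
  ultimately show "p \<in> O4"
    using p by (auto simp: O4_def is_partition_def)
qed

lemma D24_iff:
  "p \<in> D24 \<longleftrightarrow> sorted_wrt (>) p \<and> (\<forall>a\<in>set p. 0 < a \<and> a mod 4 \<noteq> 2)"
proof -
  have "sorted_wrt (\<ge>) p \<and> distinct p \<longleftrightarrow> sorted_wrt (>) p"
    using strict_sorted_iff[of "rev p"] by (simp add: sorted_wrt_rev)
  then show ?thesis
    by (auto simp: D24_def is_partition_def cong_def)
qed

section \<open>Counting chains by their least parts\<close>

text \<open>Parts decrease along the list, so a chain \<open>(i, j)\<close> has least part
  \<open>p ! j\<close> and is determined by it. A part ends a chain exactly when 4 less is not a
  part; \<open>4 <= l\<close> keeps \<open>b - 4\<close> from truncating.\<close>

lemma num_chains_eq_card: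
  assumes p: "sorted_wrt (\<lambda>a b. a \<ge> b + 4) p" and l: "4 \<le> l"
  shows "num_chains l p = card {b \<in> set p. l \<le> b \<and> b - 4 \<notin> set p}"
proof -
  have dec: "p ! j + 4 \<le> p ! i" if "i < j" "j < length p" for i j
    using p that by (simp add: sorted_wrt_iff_nth_less)
  have anti: "p ! j \<le> p ! i" if "i \<le> j" "j < length p" for i j
    using dec[of i j] that by (cases "i = j") auto
  have nth_inj: "i = j" if "p ! i = p ! j" "i < length p" "j < length p" for i j
    using dec[of i j] dec[of j i] that by (cases i j rule: linorder_cases) auto
  have Min: "Min ((!) p ` {i..j}) = p ! j" if "is_string4 p i j" for i j
    using that anti by (intro Min_eqI) (auto simp: is_string4_def)
  \<comment> \<open>With all gaps at least 4, only the next entry can equal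
    \<open>p ! j - 4\<close>.\<close>
  have next_part: "p ! j - 4 \<in> set p \<longleftrightarrow> Suc j < length p \<and> p ! j = p ! Suc j + 4"
    if "j < length p" "4 \<le> p ! j" for j
  proof
    assume "p ! j - 4 \<in> set p"
    then obtain k where k: "k < length p" "p ! k = p ! j - 4"
      by (auto simp: in_set_conv_nth)
    have "j < k"
      using anti[of k j] k that by (cases "j < k") auto
    moreover have "k \<le> Suc j"
      using dec[of j "Suc j"] dec[of "Suc j" k] k that by (cases "k \<le> Suc j") auto
    ultimately have "k = Suc j" by simp
    with k that show "Suc j < length p \<and> p ! j = p ! Suc j + 4" by auto
  next
    assume "Suc j < length p \<and> p ! j = p ! Suc j + 4"
    then show "p ! j - 4 \<in> set p" by (metis add_diff_cancel_right' nth_mem)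
  qed
  let ?C = "{(i, j). is_chain4 p i j \<and> l \<le> Min ((!) p ` {i..j})}"
  let ?B = "{b \<in> set p. l \<le> b \<and> b - 4 \<notin> set p}"
  have C: "?C = {(i, j). is_chain4 p i j \<and> l \<le> p ! j}"
    using Min by (auto simp: is_chain4_def)
  have "bij_betw (\<lambda>(i, j). p ! j) ?C ?B"
    unfolding C bij_betw_def
  proof (intro conjI inj_onI equalityI subsetI)
    fix x y
    assume x: "x \<in> {(i, j). is_chain4 p i j \<and> l \<le> p ! j}"
      and y: "y \<in> {(i, j). is_chain4 p i j \<and> l \<le> p ! j}"
      and eq: "(case x of (i, j) \<Rightarrow> p ! j) = (case y of (i, j) \<Rightarrow> p ! j)"
    obtain i j i' j' where xy: "x = (i, j)" "y = (i', j')" by (cases x, cases y)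
    have ch: "is_chain4 p i j" "is_chain4 p i' j'" using x y xy by auto
    then have "j' = j"
      using eq xy nth_inj[of j j'] by (auto simp: is_chain4_def is_string4_def)
    then have str: "is_string4 p i j" "is_string4 p i' j"
      and max: "\<And>k. is_string4 p k j \<Longrightarrow> k \<le> i \<Longrightarrow> k = i"
        "\<And>k. is_string4 p k j \<Longrightarrow> k \<le> i' \<Longrightarrow> k = i'"
      using ch by (auto simp: is_chain4_def)
    \<comment> \<open>Both strings end at \<open>j\<close>, so a longer one would extend the other,
      which is maximal.\<close>
    have "i = i'"
      using max(1)[OF str(2)] max(2)[OF str(1)] by linarith
    with \<open>j' = j\<close> xy show "x = y" by simp
  next
    fix b assume "b \<in> (\<lambda>(i, j). p ! j) ` {(i, j). is_chain4 p i j \<and> l \<le> p ! j}"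
    then obtain i j where ch: "is_chain4 p i j" and b: "b = p ! j" "l \<le> b" by auto
    have str: "is_string4 p i j" and j: "j < length p" "i \<le> j"
      using ch by (auto simp: is_chain4_def is_string4_def)
    have "\<not> (Suc j < length p \<and> p ! j = p ! Suc j + 4)"
    proof
      assume *: "Suc j < length p \<and> p ! j = p ! Suc j + 4"
      have "is_string4 p i (Suc j)"
        using str * by (auto simp: is_string4_def less_Suc_eq)
      with ch have "Suc j = j"
        unfolding is_chain4_def by (metis le_SucI order_refl)
      then show False by simp
    qed
    then show "b \<in> ?B"
      using next_part[of j] j b l by auto
  next
    fix b assume b: "b \<in> ?B"
    then obtain j where j: "j < length p" "b = p ! j" by (auto simp: in_set_conv_nth)
    \<comment> \<open>The smallest left end makes the string maximal on the left; on the right,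
      \<open>b - 4\<close> not being a part stops it.\<close>
    define i where "i = (LEAST i. is_string4 p i j)"
    have "is_string4 p j j" using j by (auto simp: is_string4_def)
    then have str: "is_string4 p i j"
      unfolding i_def by (rule LeastI)
    have "i' = i \<and> j' = j" if s: "is_string4 p i' j'" "i' \<le> i" "j \<le> j'" for i' j'
    proof -
      have "j' = j"
      proof (rule ccontr)
        assume "j' \<noteq> j"
        then have "j < j'" "i' \<le> j" using s str by (auto simp: is_string4_def)
        then have "p ! j = p ! Suc j + 4" "Suc j < length p"
          using s by (auto simp: is_string4_def)
        then show False
          using next_part[of j] j b l by auto
      qed
      moreover from this have "i \<le> i'"
        unfolding i_def using s by (intro Least_le) simp
      ultimately show ?thesis using s by simp
    qed
    then have "is_chain4 p i j" using str by (auto simp: is_chain4_def)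
    then show "b \<in> (\<lambda>(i, j). p ! j) ` {(i, j). is_chain4 p i j \<and> l \<le> p ! j}"
      using b j by force
  qed
  then show ?thesis
    unfolding num_chains_def by (rule bij_betw_same_card)
qed

lemma num_chains_5_eq:
  assumes "p \<in> O4"
  shows "num_chains 5 p = card (chain_starts 0 {i. 2 * i + 1 \<in> set p})"
proof -
  have "bij_betw (\<lambda>i. 2 * i + 5) (chain_starts 0 {i. 2 * i + 1 \<in> set p})
    {b \<in> set p. 5 \<le> b \<and> b - 4 \<notin> set p}"
    unfolding bij_betw_def
  proof (intro conjI equalityI subsetI)
    fix b assume b: "b \<in> {b \<in> set p. 5 \<le> b \<and> b - 4 \<notin> set p}"
    then have "odd b" using assms by (auto simp: O4_iff)
    then obtain k where "b = 2 * k + 1" by (rule oddE)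
    with b have "b = 2 * (k - 2) + 5" by auto
    with b show "b \<in> (\<lambda>i. 2 * i + 5) ` chain_starts 0 {i. 2 * i + 1 \<in> set p}"
      by (intro image_eqI[of _ _ "k - 2"]) (auto simp: chain_starts_def numeral_eq_Suc)
  qed (auto simp: inj_on_def chain_starts_def numeral_eq_Suc)
  then show ?thesis
    using assms by (subst num_chains_eq_card) (auto simp: O4_def bij_betw_same_card)
qed

section \<open>Partition statistics and the coefficients of both generating functions\<close>

lemma length_sorted_gt: "sorted_wrt (>) (p :: nat list) \<Longrightarrow> length p = card (set p)"
  by (simp add: distinct_card sorted_gt_distinct)

lemma sum_list_sorted_gt: "sorted_wrt (>) (p :: nat list) \<Longrightarrow> sum_list p = \<Sum>(set p)"
  by (simp add: distinct_sum_list_conv_Sum sorted_gt_distinct)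

lemma num_parts_cong_sorted_gt:
  "sorted_wrt (>) p \<Longrightarrow> num_parts_cong p r m = card {b \<in> set p. b mod m = r mod m}"
  unfolding num_parts_cong_def cong_def
  by (subst distinct_card[symmetric]) (auto simp: sorted_gt_distinct distinct_filter intro!: arg_cong[where f = card])

lemma prod_fps_monom:
  "(\<Prod>b\<in>B. fps_const (f b) * fps_X ^ g b) = fps_const (\<Prod>b\<in>B. f b) * fps_X ^ (\<Sum>b\<in>B. g b)"
  for f :: "'b \<Rightarrow> 'a::comm_ring_1"
  by (induction B rule: infinite_finite_induct) (simp_all add: power_add mult_ac flip: fps_const_mult)

lemma gap_weight_nth:
  "fps_nth (gap_weight z 0 A) n = (if (\<Sum>i\<in>A. 2 * i + 1) = n
     then z ^ card A * (1 - z\<^sup>2) ^ card (chain_starts 0 A) else 0)"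
proof -
  have "gap_weight z 0 A = fps_const (z ^ card A * (1 - z\<^sup>2) ^ card (chain_starts 0 A))
      * fps_X ^ (\<Sum>i\<in>A. 2 * i + 1)"
    unfolding gap_weight_def part_term_def prod_fps_monom
    by (simp add: fps_const_power mult_ac flip: fps_const_mult)
  then show ?thesis by (simp only: fps_mult_left_const_nth fps_X_power_nth) auto
qed

lemma member_le_Sum: "finite B \<Longrightarrow> (b::nat) \<in> B \<Longrightarrow> b \<le> \<Sum>B"
  by (rule member_le_sum) auto

text \<open>The truncation loses nothing: a part \<open>2 * i + 1\<close> of a partition of
  \<open>n\<close> is at most \<open>n\<close>, hence \<open>i < M\<close>.\<close>

lemma sum_O4_eq:
  assumes "n < M"
  shows "(\<Sum>p | p \<in> O4 \<and> sum_list p = n. z ^ length p * (1 - z\<^sup>2) ^ num_chains 5 p)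
    = fps_nth (\<Sum>A\<in>gapped 0 M. gap_weight z 0 A) n"
proof -
  let ?d = "\<lambda>i::nat. 2 * i + 1"
  have inj: "inj_on ?d A" for A by (auto simp: inj_on_def)
  have "(\<Sum>p | p \<in> O4 \<and> sum_list p = n. z ^ length p * (1 - z\<^sup>2) ^ num_chains 5 p)
      = (\<Sum>A | A \<in> gapped 0 M \<and> (\<Sum>i\<in>A. ?d i) = n. z ^ card A * (1 - z\<^sup>2) ^ card (chain_starts 0 A))"
  proof (rule sum.reindex_bij_witness[where i = "\<lambda>A. desc_list (?d ` A)" and j = "\<lambda>p. {i. ?d i \<in> set p}"])
    fix p assume "p \<in> {p. p \<in> O4 \<and> sum_list p = n}"
    then have p: "p \<in> O4" "sum_list p = n" by auto
    then have sorted: "sorted_wrt (>) p" and gap: "\<And>a. a \<in> set p \<Longrightarrow> odd a \<and> a + 2 \<notin> set p"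
      by (auto simp: O4_iff)
    have "a \<in> ?d ` {i. ?d i \<in> set p}" if a: "a \<in> set p" for a
    proof -
      obtain k where "a = ?d k" using gap[OF a] by (auto elim: oddE)
      with a show ?thesis by blast
    qed
    then have im: "?d ` {i. ?d i \<in> set p} = set p"
      by blast
    show "desc_list (?d ` {i. ?d i \<in> set p}) = p"
      unfolding im using sorted by (rule desc_list_set)
    have sum: "(\<Sum>i | ?d i \<in> set p. ?d i) = n"
      using sum.reindex[where h = ?d and g = id and A = "{i. ?d i \<in> set p}", OF inj] im p(2) sum_list_sorted_gt[OF sorted] by simp
    have "i < M" if "?d i \<in> set p" for i
      using member_le_Sum[OF _ that] p(2) sum_list_sorted_gt[OF sorted] assms by simp
    moreover have "?d (Suc i) \<notin> set p" if "?d i \<in> set p" for i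
      using gap[OF that] by simp
    ultimately show "{i. ?d i \<in> set p} \<in> {A. A \<in> gapped 0 M \<and> (\<Sum>i\<in>A. ?d i) = n}"
      using sum by (auto simp: gapped_def)
    have "card {i. ?d i \<in> set p} = length p"
      using card_image[OF inj, of "{i. ?d i \<in> set p}"] im length_sorted_gt[OF sorted] by simp
    then show "z ^ card {i. ?d i \<in> set p} * (1 - z\<^sup>2) ^ card (chain_starts 0 {i. ?d i \<in> set p})
        = z ^ length p * (1 - z\<^sup>2) ^ num_chains 5 p"
      using num_chains_5_eq[OF p(1)] by simp
  next
    fix A assume "A \<in> {A. A \<in> gapped 0 M \<and> (\<Sum>i\<in>A. ?d i) = n}"
    then have A: "A \<in> gapped 0 M" "(\<Sum>i\<in>A. ?d i) = n" by auto
    then have fin: "finite (?d ` A)" using gapped_finite_elem by blast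
    show "{i. ?d i \<in> set (desc_list (?d ` A))} = A"
      unfolding set_desc_list[OF fin] by auto
    have "sum_list (desc_list (?d ` A)) = n"
      unfolding sum_list_sorted_gt[OF sorted_desc_list] set_desc_list[OF fin]
      using sum.reindex[where h = ?d and g = id and A = A, OF inj] A by simp
    moreover have "?d i + 2 \<notin> ?d ` A" if "i \<in> A" for i
    proof
      assume "?d i + 2 \<in> ?d ` A"
      then obtain k where "k \<in> A" "?d i + 2 = ?d k" by blast
      moreover from this have "k = Suc i" by linarith
      ultimately have "Suc i \<in> A" by simp
      with A that show False by (auto simp: gapped_def)
    qed
    then have "desc_list (?d ` A) \<in> O4"
      unfolding O4_iff set_desc_list[OF fin] using sorted_desc_list by auto
    ultimately show "desc_list (?d ` A) \<in> {p. p \<in> O4 \<and> sum_list p = n}" by simp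
  qed
  also have "\<dots> = fps_nth (\<Sum>A\<in>gapped 0 M. gap_weight z 0 A) n"
    unfolding fps_sum_nth gap_weight_nth by (rule sum.inter_filter[OF finite_gapped])
  finally show ?thesis .
qed

text \<open>Expanding the product selects a set of odd numbers and multiples of 4. For
  \<open>n < m\<close> the range \<open>U\<close> contains every admissible part up to
  \<open>n\<close>, and larger elements cannot occur in a set with sum \<open>n\<close>.\<close>

lemma euler_prod_nth:
  fixes z :: "'a::comm_ring_1"
  assumes "n < m"
  shows "fps_nth (\<Prod>i<m. (1 + part_term z i) * (1 - fps_const (z\<^sup>2) * fps_X ^ (4 * i + 4))) n
    = (\<Sum>p | p \<in> D24 \<and> sum_list p = n.
         z ^ num_parts_cong p 1 2 * (- (z\<^sup>2)) ^ num_parts_cong p 0 2)"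
proof -
  define w where "w b = (if odd b then z else - (z\<^sup>2))" for b :: nat
  define U where "U = (\<lambda>i. 2 * i + 1) ` {..<m} \<union> (\<lambda>i. 4 * i + 4) ` {..<m}"
  have fU: "finite U" by (simp add: U_def)
  have U: "b \<in> U \<longleftrightarrow> 0 < b \<and> b mod 4 \<noteq> 2" if "b \<le> n" for b
  proof (cases "odd b")
    case True
    then obtain k where "b = 2 * k + 1" by (rule oddE)
    moreover from True have "b mod 4 \<noteq> 2" by presburger
    ultimately show ?thesis using that assms by (auto simp: U_def)
  next
    case False
    have "b = 4 * (b div 4 - 1) + 4" "b div 4 - 1 < m" if "b mod 4 = 0" "0 < b"
      using that \<open>b \<le> n\<close> assms by auto
    then have "b \<in> (\<lambda>i. 4 * i + 4) ` {..<m} \<longleftrightarrow> 0 < b \<and> b mod 4 = 0"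
      by auto
    moreover have "b mod 4 = 0 \<longleftrightarrow> b mod 4 \<noteq> 2" using False by presburger
    ultimately show ?thesis using False by (auto simp: U_def)
  qed
  have parity: "b mod 2 = 1 mod 2 \<longleftrightarrow> odd b" "b mod 2 = 0 mod 2 \<longleftrightarrow> even b" for b :: nat
    by presburger+
  have disj: "(\<lambda>i. 2 * i + 1) ` {..<m} \<inter> (\<lambda>i. 4 * i + 4) ` {..<m} = {}"
    by auto presburger
  have inj: "inj_on (\<lambda>i::nat. 2 * i + 1) {..<m}" "inj_on (\<lambda>i::nat. 4 * i + 4) {..<m}"
    by (simp_all add: inj_on_def)
  have factor: "fps_const (w (2 * i + 1)) * fps_X ^ (2 * i + 1) + 1 = 1 + part_term z i"
    "fps_const (w (4 * i + 4)) * fps_X ^ (4 * i + 4) + 1 = 1 - fps_const (z\<^sup>2) * fps_X ^ (4 * i + 4)" for i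
    by (simp_all add: w_def part_term_def fps_const_neg[symmetric] del: fps_const_neg power_Suc)
  have "(\<Prod>i<m. (1 + part_term z i) * (1 - fps_const (z\<^sup>2) * fps_X ^ (4 * i + 4)))
      = (\<Prod>b\<in>U. fps_const (w b) * fps_X ^ b + 1)"
    unfolding U_def
    by (simp only: prod.union_disjoint[OF finite_imageI finite_imageI disj] finite_lessThan
        prod.reindex[OF inj(1)] prod.reindex[OF inj(2)] prod.distrib o_def factor)
  also have "\<dots> = (\<Sum>B\<in>Pow U. fps_const (\<Prod>b\<in>B. w b) * fps_X ^ \<Sum>B)"
    unfolding prod_add[OF fU] prod_fps_monom by simp
  also have "fps_nth \<dots> n = (\<Sum>B\<in>Pow U. if \<Sum>B = n then \<Prod>b\<in>B. w b else 0)"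
    unfolding fps_sum_nth fps_mult_left_const_nth fps_X_power_nth
    by (intro sum.cong) auto
  also have "\<dots> = (\<Sum>B | B \<in> Pow U \<and> \<Sum>B = n. \<Prod>b\<in>B. w b)"
    using fU by (intro sum.inter_filter[symmetric]) simp
  also have "\<dots> = (\<Sum>p | p \<in> D24 \<and> sum_list p = n.
         z ^ num_parts_cong p 1 2 * (- (z\<^sup>2)) ^ num_parts_cong p 0 2)"
  proof (rule sum.reindex_bij_witness[where i = set and j = desc_list])
    fix B assume "B \<in> {B. B \<in> Pow U \<and> \<Sum>B = n}"
    then have B: "B \<subseteq> U" "\<Sum>B = n" by auto
    then have fin: "finite B" using fU finite_subset by blast
    show "set (desc_list B) = B" using fin by (rule set_desc_list)
    have "0 < b \<and> b mod 4 \<noteq> 2" if "b \<in> B" for b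
      using U[of b] member_le_Sum[OF fin that] B that by auto
    then show "desc_list B \<in> {p. p \<in> D24 \<and> sum_list p = n}"
      using B by (simp add: D24_iff sorted_desc_list sum_list_sorted_gt set_desc_list[OF fin])
    have "(\<Prod>b\<in>B. w b) = z ^ card {b \<in> B. odd b} * (- (z\<^sup>2)) ^ card {b \<in> B. even b}"
      unfolding w_def using fin by (simp add: prod.If_cases Int_def conj_commute)
    then show "z ^ num_parts_cong (desc_list B) 1 2 * (- (z\<^sup>2)) ^ num_parts_cong (desc_list B) 0 2
        = (\<Prod>b\<in>B. w b)"
      by (simp only: num_parts_cong_sorted_gt[OF sorted_desc_list] set_desc_list[OF fin] parity)
  next
    fix p assume "p \<in> {p. p \<in> D24 \<and> sum_list p = n}"
    then have p: "sorted_wrt (>) p" "sum_list p = n" "\<And>a. a \<in> set p \<Longrightarrow> 0 < a \<and> a mod 4 \<noteq> 2"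
      by (auto simp: D24_iff)
    show "desc_list (set p) = p" using p(1) by (rule desc_list_set)
    show "set p \<in> {B. B \<in> Pow U \<and> \<Sum>B = n}"
      using p U sum_list_sorted_gt[OF p(1)] member_le_Sum[of "set p"] by auto
  qed
  finally show ?thesis .
qed

theorem theorem1:
  fixes z :: "'a::comm_ring_1" and n :: nat
  shows "(\<Sum>p | p \<in> O4 \<and> sum_list p = n. z ^ length p * (1 - z\<^sup>2) ^ num_chains 5 p)
       = (\<Sum>p | p \<in> D24 \<and> sum_list p = n.
            z ^ num_parts_cong p 1 2 * (- (z\<^sup>2)) ^ num_parts_cong p 0 2)"
proof -
  \<comment> \<open>Large enough that coefficient \<open>n\<close> is seen modulo
    \<open>fps_X ^ m\<close> and that the indices of the parts 1 and 3 are kept.\<close>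
  define m where "m = n + 2"
  let ?P = "\<Prod>i<m. (1 + part_term z i) * (1 - fps_const (z\<^sup>2) * fps_X ^ (4 * i + 4))"
  let ?G = "\<Sum>A\<in>gapped 0 m. gap_weight z 0 A"
  have m: "n < m" "2 \<le> m" by (simp_all add: m_def)
  \<comment> \<open>\<open>o4_gf z 0\<close> equals \<open>?P * o4_gf z m\<close>, is congruent to
    \<open>?G\<close>, and \<open>o4_gf z m\<close> is congruent to 1, all modulo
    \<open>fps_X ^ m\<close>.\<close>
  have "fps_X ^ m dvd ?P * (o4_gf z m - 1) - (o4_gf z 0 - ?G)"
    using m by (intro dvd_diff dvd_mult o4_gf_one X_power_dvd_o4_gf_diff)
  also have "\<dots> = ?G - ?P"
    unfolding o4_gf_prod[of z m] by (simp add: algebra_simps)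
  finally have "fps_nth ?G n = fps_nth ?P n"
    using m(1) by (simp add: fps_X_power_dvd_iff)
  then show ?thesis
    unfolding sum_O4_eq[OF m(1)] euler_prod_nth[OF m(1)] .
qed

end
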